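(* The semiring $\mathbb{N}[x]$ of polynomials in one variable with natural number coefficients is not Noetherian.
   Context: $\mathbb N$ is the semiring of natural numbers (including $0$), and $\mathbb N[x]$ has the usual addition and multiplication. A congruence on a semiring is an equivalence relation compatible with both operations. A semiring is Noetherian if it satisfies the ascending chain condition on congruences. *)

theory Defs
  imports "HOL-Computational_Algebra.Polynomial"
begin

definition semiring_congruence :: "('a::semiring_1 \<times> 'a) set \<Rightarrow> bool" where
  "semiring_congruence r \<longleftrightarrow>
     equiv UNIV r \<and>
     (\<forall>a b c d. (a, b) \<in> r \<longrightarrow> (c, d) \<in> r \<longrightarrow> (a + c, b + d) \<in> r) \<and>
     (\<forall>a b c d. (a, b) \<in> r \<longrightarrow> (c, d) \<in> r \<longrightarrow> (a * c, b * d) \<in> r)"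

definition noetherian_semiring :: "'a::semiring_1 itself \<Rightarrow> bool" where
  "noetherian_semiring _ \<longleftrightarrow>
     (\<forall>C :: nat \<Rightarrow> ('a \<times> 'a) set.
        (\<forall>n. semiring_congruence (C n)) \<longrightarrow> incseq C \<longrightarrow> (\<exists>N. \<forall>n\<ge>N. C n = C N))"

end

theory Submission
  imports Defs
begin

text \<open>
  Collapsing a set \<open>I\<close> of a semiring to one point, and nothing else, is a congruence as soon as
  \<open>I\<close> absorbs addition of arbitrary elements and multiplication by nonzero elements.  So it
  suffices to find a strictly increasing sequence of nonempty absorbing sets in \<open>\<nat>[x]\<close>.  Since
  natural coefficients cannot cancel, supports of polynomials only grow under addition, and the
  support of a product with a nonzero polynomial contains a translate of the support of the other
  factor.  Hence, for each \<open>n \<ge> 1\<close>, the polynomials whose support contains two exponents at a positive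
  distance of at most \<open>n\<close> form an absorbing set.  The binomial \<open>1 + x\<^sup>m\<close> with \<open>m \<ge> 1\<close> has only the
  distance \<open>m\<close> in its support, so it enters this family exactly at \<open>n = m\<close>, and the chain
  of congruences never stabilises.
\<close>

definition collapse :: "'a set \<Rightarrow> ('a \<times> 'a) set" where
  "collapse I = Id \<union> I \<times> I"

text \<open>
  Multiplication by \<open>0\<close> need not preserve \<open>I\<close>, but multiplying both entries of a pair by \<open>0\<close>
  gives \<open>(0, 0)\<close>, which the identity part of the relation provides.  If \<open>0 \<in> I\<close>, then
  additive absorption makes \<open>I\<close> the whole semiring.
\<close>

lemma semiring_congruence_collapse:
  fixes I :: "'a::semiring_1 set"
  assumes add: "\<And>a b. a \<in> I \<Longrightarrow> a + b \<in> I"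
    and mult_right: "\<And>a c. a \<in> I \<Longrightarrow> c \<noteq> 0 \<Longrightarrow> a * c \<in> I"
    and mult_left: "\<And>a c. a \<in> I \<Longrightarrow> c \<noteq> 0 \<Longrightarrow> c * a \<in> I"
  shows "semiring_congruence (collapse I)"
proof -
  have add': "b + a \<in> I" if "a \<in> I" for a b
    using add[OF that, of b] by (simp add: add.commute)
  have mult: "a * c \<in> I" if "a \<in> I" "c \<in> I" for a c
  proof (cases "c = 0")
    case True
    then show ?thesis using add[of 0 "a * c"] that by simp
  qed (use mult_right that in blast)
  have "equiv UNIV (collapse I)"
    by (rule equivI) (auto simp: collapse_def refl_on_def sym_def trans_def)
  moreover have "(a + c, b + d) \<in> collapse I"
    if "(a, b) \<in> collapse I" "(c, d) \<in> collapse I" for a b c d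
    using that add add' by (auto simp: collapse_def)
  moreover have "(a * c, b * d) \<in> collapse I"
    if ab: "(a, b) \<in> collapse I" and cd: "(c, d) \<in> collapse I" for a b c d
  proof -
    consider "a = b" "c = d" | "a = b" "c \<in> I" "d \<in> I" | "a \<in> I" "b \<in> I" "c = d"
      | "a \<in> I" "b \<in> I" "c \<in> I" "d \<in> I"
      using ab cd by (auto simp: collapse_def)
    then show ?thesis
    proof cases
      case 2
      then show ?thesis using mult_left by (cases "a = 0") (auto simp: collapse_def)
    next
      case 3
      then show ?thesis using mult_right by (cases "c = 0") (auto simp: collapse_def)
    qed (auto simp: collapse_def mult)
  qed
  ultimately show ?thesis
    unfolding semiring_congruence_def by blast
qed

definition has_gap_at_most :: "nat \<Rightarrow> nat poly set" where
  "has_gap_at_most n =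
     {p. \<exists>k i. 1 \<le> i \<and> i \<le> n \<and> coeff p k \<noteq> 0 \<and> coeff p (k + i) \<noteq> 0}"

lemma has_gap_at_most_mono: "m \<le> n \<Longrightarrow> has_gap_at_most m \<subseteq> has_gap_at_most n"
  unfolding has_gap_at_most_def by (blast intro: order_trans)

lemma coeff_mult_nonzero_nat:
  fixes p q :: "nat poly"
  assumes "coeff p i \<noteq> 0" "coeff q j \<noteq> 0"
  shows "coeff (p * q) (i + j) \<noteq> 0"
proof -
  have "coeff p i * coeff q (i + j - i) \<le> coeff (p * q) (i + j)"
    unfolding coeff_mult
    by (rule member_le_sum[where f = "\<lambda>k. coeff p k * coeff q (i + j - k)"]) simp_all
  moreover have "0 < coeff p i * coeff q (i + j - i)"
    using assms by simp
  ultimately show ?thesis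
    by linarith
qed

text \<open>
  Multiplication by a polynomial with nonzero coefficient at \<open>j\<close> moves both exponents
  of the pair by \<open>j\<close>, so their distance survives.
\<close>

lemma semiring_congruence_collapse_has_gap_at_most:
  "semiring_congruence (collapse (has_gap_at_most n))"
proof (rule semiring_congruence_collapse)
  show "p + q \<in> has_gap_at_most n" if "p \<in> has_gap_at_most n" for p q
    using that by (auto simp: has_gap_at_most_def)
  show mult: "p * q \<in> has_gap_at_most n" if p: "p \<in> has_gap_at_most n" and q: "q \<noteq> 0" for p q
  proof -
    obtain k i where ki: "1 \<le> i" "i \<le> n" "coeff p k \<noteq> 0" "coeff p (k + i) \<noteq> 0"
      using p unfolding has_gap_at_most_def by blast
    obtain j where j: "coeff q j \<noteq> 0"
      using q by (auto simp: poly_eq_iff)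
    have "coeff (p * q) (k + j) \<noteq> 0" "coeff (p * q) (k + j + i) \<noteq> 0"
      using coeff_mult_nonzero_nat[OF ki(3) j] coeff_mult_nonzero_nat[OF ki(4) j]
      by (simp_all add: ac_simps)
    then show ?thesis
      using ki(1,2) unfolding has_gap_at_most_def by blast
  qed
  show "q * p \<in> has_gap_at_most n" if "p \<in> has_gap_at_most n" "q \<noteq> 0" for p q
    using mult[OF that] by (simp add: mult.commute)
qed

lemma binomial_in_has_gap_at_most_iff:
  assumes "1 \<le> m"
  shows "1 + monom 1 m \<in> has_gap_at_most n \<longleftrightarrow> m \<le> n"
proof -
  have support: "coeff (1 + monom 1 m :: nat poly) k \<noteq> 0 \<longleftrightarrow> k = 0 \<or> k = m" for k
    by auto
  show ?thesis
  proof
    assume "1 + monom 1 m \<in> has_gap_at_most n"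
    then show "m \<le> n"
      unfolding has_gap_at_most_def mem_Collect_eq support by auto
  next
    assume "m \<le> n"
    then show "1 + monom 1 m \<in> has_gap_at_most n"
      unfolding has_gap_at_most_def mem_Collect_eq support
      using assms by (intro exI[of _ 0] exI[of _ m]) simp
  qed
qed

theorem corollary5p10: "\<not> noetherian_semiring TYPE(nat poly)"
proof
  assume noetherian: "noetherian_semiring TYPE(nat poly)"
  \<comment> \<open>The shift to \<open>Suc n\<close> puts \<open>1 + x\<close> in every collapsed set: the relations can only be
    told apart by comparing a new element with one that is already collapsed.\<close>
  define C where "C n = collapse (has_gap_at_most (Suc n))" for n
  have "semiring_congruence (C n)" for n
    unfolding C_def by (rule semiring_congruence_collapse_has_gap_at_most)
  moreover have "incseq C"
    unfolding incseq_def C_def collapse_def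
    by (intro allI impI Un_mono Sigma_mono has_gap_at_most_mono order_refl Suc_le_mono[THEN iffD2])
  ultimately obtain N where N: "\<forall>n\<ge>N. C n = C N"
    using noetherian unfolding noetherian_semiring_def by blast
  have stable: "C (Suc N) = C N"
    by (rule N[rule_format]) simp
  define b :: "nat \<Rightarrow> nat poly" where "b m = 1 + monom 1 m" for m
  have b_iff: "b m \<in> has_gap_at_most n \<longleftrightarrow> m \<le> n" if "1 \<le> m" for m n
    unfolding b_def by (rule binomial_in_has_gap_at_most_iff[OF that])
  have "(b 1, b (Suc (Suc N))) \<in> C (Suc N)"
    by (simp add: C_def collapse_def b_iff)
  then have "b 1 = b (Suc (Suc N)) \<or> b (Suc (Suc N)) \<in> has_gap_at_most (Suc N)"
    unfolding stable unfolding C_def collapse_def by blast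
  moreover have "b 1 \<in> has_gap_at_most (Suc N)" "b (Suc (Suc N)) \<notin> has_gap_at_most (Suc N)"
    by (simp_all add: b_iff)
  ultimately show False
    by metis
qed

end
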